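(* Suppose that for all $K\in\mathcal T$ and $0\le n\le N-1$ one has $\eta>1/\varrho_K^{n+1}$ and $$\delta t\le\frac{|K|\varrho_K^{n+1}}{2\sum_{\sigma\in\mathcal E(K),\,\sigma=K|L}|\sigma|\,\varrho_L^{n+1}\bigl(-(w^n_{\sigma,K})^-\bigr)}.$$ Then the discrete solutions of the scheme $[\mathcal P_\varepsilon^{h_{\mathcal T}}]$ satisfy: (1) the local in-time entropy inequality $$\sum_{K\in\mathcal T}|K|\Bigl(\frac12\varrho_K^{n+1}|\mathbf u_K^{n+1}|^2+\frac1{\varepsilon^2}\Pi_\gamma(\varrho_K^{n+1})\Bigr)\le\sum_{K\in\mathcal T}|K|\Bigl(\frac12\varrho_K^n|\mathbf u_K^n|^2+\frac1{\varepsilon^2}\Pi_\gamma(\varrho_K^n)\Bigr)$$ for each $0\le n\le N-1$; (2) the global entropy estimate $$\sum_{K\in\mathcal T}|K|\Bigl(\frac12\varrho_K^n|\mathbf u_K^n|^2+\frac1{\varepsilon^2}\Pi_\gamma(\varrho_K^n)\Bigr)+\frac1{\varepsilon^4}\sum_{r=0}^{n-1}\delta t^2\sum_{K\in\mathcal T}|K|\Bigl(\eta-\frac1{\varrho_K^{r+1}}\Bigr)\bigl|(\nabla_{\mathcal T}p^{r+1})_K\bigr|^2\le C$$ with a constant $C>0$ independent of $\varepsilon$.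
   Context: **Setting.** $d\in\{2,3\}$; periodic boundary conditions, $\Omega=\mathbb T^d$; $p(\varrho)=\varrho^\gamma$, $\gamma>1$; $\psi_\gamma(\varrho)=\varrho^\gamma/(\gamma-1)$, $\Pi_\gamma(\varrho)=\psi_\gamma(\varrho)-\psi_\gamma(1)-\psi_\gamma'(1)(\varrho-1)$; $\varepsilon>0$. **Mesh.** $\mathcal T$ is a finite family of closed axis-parallel (possibly non-uniform) rectangles/cuboids $K$ covering $\overline\Omega$; two distinct cells share no edge or exactly one edge $\sigma=K|L$. $\mathcal E(K)$: the edges (faces) of $K$; $\mathcal E_{ext}$: edges on $\partial\Omega$; $|K|,|\sigma|$: Lebesgue measures; $\boldsymbol\nu_{\sigma,K}$: unit normal to $\sigma$ outward from $K$. Functions constant on each cell have value $q_K$ on $K$; $(\Pi_{\mathcal T}q)_K=|K|^{-1}\int_Kq\,dx$; $\{\!\{q\}\!\}_\sigma=(q_K+q_L)/2$. **Discrete operators.** $w_{\sigma,K}=\{\!\{\mathbf w\}\!\}_\sigma\cdot\boldsymbol\nu_{\sigma,K}$ if $\sigma=K|L$ and $0$ if $\sigma\in\mathcal E_{ext}$; $(\nabla_{\mathcal T}q)_K=|K|^{-1}\sum_{\sigma=K|L\in\mathcal E(K)}|\sigma|\frac{q_L-q_K}2\boldsymbol\nu_{\sigma,K}$; $(\mathrm{div}^{up}_{\mathcal T}(q,\mathbf w))_K=|K|^{-1}\sum_{\sigma=K|L\in\mathcal E(K)}|\sigma|\{q_K(w_{\sigma,K})^++q_L(w_{\sigma,K})^-\}$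 (componentwise for vector $q$). Write $a^\pm=(a\pm|a|)/2$. **Scheme $[\mathcal P_\varepsilon^{h_{\mathcal T}}]$.** $t^n=n\,\delta t$, $t^N=T$. $\varrho^0=\Pi_{\mathcal T}\varrho_{0,\varepsilon}$, $\mathbf u^0=\Pi_{\mathcal T}\mathbf u_{0,\varepsilon}$ for given initial data with $\varrho_{0,\varepsilon}>0$; for $0\le n\le N-1$ and all $K$, with $p^{n}_K=p(\varrho^{n}_K)$, $\frac1{\delta t}(\varrho_K^{n+1}-\varrho_K^n)+(\mathrm{div}^{up}_{\mathcal T}(\varrho^{n+1},\mathbf w^n))_K=0$, $\frac1{\delta t}(\varrho_K^{n+1}\mathbf u_K^{n+1}-\varrho_K^n\mathbf u_K^n)+(\mathrm{div}^{up}_{\mathcal T}(\varrho^{n+1}\mathbf u^n,\mathbf w^n))_K+\frac1{\varepsilon^2}(\nabla_{\mathcal T}p^{n+1})_K=0$, where $\mathbf w^n=\mathbf u^n-\delta\mathbf u^{n+1}$, $\delta\mathbf u_K^{n+1}=\frac{\eta\,\delta t}{\varepsilon^2}(\nabla_{\mathcal T}p^{n+1})_K$, $\eta>0$, and $(w^n_{\sigma,K})^+=u_{\sigma,K}^{n,+}-\delta u_{\sigma,K}^{n+1,-}\ge0$, $(w^n_{\sigma,K})^-=u_{\sigma,K}^{n,-}-\delta u_{\sigma,K}^{n+1,+}\le0$. Discrete solutions have $\varrho^n>0$. **Standing assumption.** The initial energy is bounded uniformly in $\varepsilon$: $\sum_K|K|(\frac12\varrho_K^0|\mathbf u_K^0|^2+\frac1{\varepsilon^2}\Pi_\gamma(\varrho_K^0))\le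 C_0$ with $C_0$ independent of $\varepsilon$. *)

theory Defs
  imports "HOL-Analysis.Analysis"
begin

text \<open>The physical space is a Euclidean space \<open>'a\<close>; axis-parallel means parallel to the vectors of
  \<open>Basis\<close>. The flat torus is the quotient of \<open>'a\<close> by the lattice with period \<open>per \<bullet> i\<close> in direction
  \<open>i\<close>, represented by the fundamental box \<open>cbox 0 per\<close> with opposite sides glued
  (\<open>per = One\<close> is the unit torus).\<close>

definition lattice :: "'a::euclidean_space \<Rightarrow> 'a set" where
  "lattice per = {z. \<forall>i\<in>Basis. \<exists>k::int. z \<bullet> i = of_int k * (per \<bullet> i)}"

definition periodic :: "'a::euclidean_space \<Rightarrow> ('a \<Rightarrow> 'b) \<Rightarrow> bool" where
  "periodic per f \<longleftrightarrow> (\<forall>x. \<forall>z\<in>lattice per. f (x + z) = f x)"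


section \<open>Cells and edges\<close>

definition axis_normals :: "'a::euclidean_space set" where
  "axis_normals = Basis \<union> uminus ` Basis"

text \<open>The part of the box \<open>K\<close> that lies furthest in direction \<open>v\<close>.\<close>

definition face :: "'a::euclidean_space set \<Rightarrow> 'a \<Rightarrow> 'a set" where
  "face K v = {x\<in>K. \<forall>y\<in>K. y \<bullet> v \<le> x \<bullet> v}"

definition edges :: "'a::euclidean_space set \<Rightarrow> 'a set set" where
  "edges K = face K ` axis_normals"

definition outer_normal :: "'a::euclidean_space set \<Rightarrow> 'a set \<Rightarrow> 'a" where
  "outer_normal \<sigma> K = (THE v. v \<in> axis_normals \<and> \<sigma> = face K v)"

text \<open>The measure of an edge is the \<open>(d - 1)\<close>-dimensional Lebesgue measure of its image in the
  coordinates other than the (unique) one that is constant on the edge.\<close>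

definition edge_axis :: "'a::euclidean_space set \<Rightarrow> 'a" where
  "edge_axis \<sigma> = (THE i. i \<in> Basis \<and> (\<exists>c. \<forall>x\<in>\<sigma>. x \<bullet> i = c))"

definition edge_measure :: "'a::euclidean_space set \<Rightarrow> real" where
  "edge_measure \<sigma> =
     measure (\<Pi>\<^sub>M i\<in>Basis - {edge_axis \<sigma>}. lborel)
       ((\<lambda>x. \<lambda>i\<in>Basis - {edge_axis \<sigma>}. x \<bullet> i) ` \<sigma>)"

abbreviation cell_measure :: "'a::euclidean_space set \<Rightarrow> real" where
  "cell_measure K \<equiv> measure lborel K"

text \<open>Two subsets of the fundamental box are the same subset of the torus iff a lattice translation
  maps one to the other. \<open>is_common_edge per \<T> K L \<sigma>\<close> expresses \<open>\<sigma> = K|L\<close> on the torus; \<open>\<sigma>\<close> is the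
  representative of the edge that lies in \<open>K\<close>.\<close>

definition same_edge :: "'a::euclidean_space \<Rightarrow> 'a set \<Rightarrow> 'a set \<Rightarrow> bool" where
  "same_edge per \<sigma> \<tau> \<longleftrightarrow> (\<exists>z\<in>lattice per. \<tau> = (+) z ` \<sigma>)"

definition is_common_edge ::
  "'a::euclidean_space \<Rightarrow> 'a set set \<Rightarrow> 'a set \<Rightarrow> 'a set \<Rightarrow> 'a set \<Rightarrow> bool" where
  "is_common_edge per \<T> K L \<sigma> \<longleftrightarrow>
     K \<in> \<T> \<and> L \<in> \<T> \<and> L \<noteq> K \<and> \<sigma> \<in> edges K \<and> (\<exists>\<tau>\<in>edges L. same_edge per \<sigma> \<tau>)"

definition int_edges :: "'a::euclidean_space \<Rightarrow> 'a set set \<Rightarrow> 'a set \<Rightarrow> 'a set set" where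
  "int_edges per \<T> K = {\<sigma>\<in>edges K. \<exists>L. is_common_edge per \<T> K L \<sigma>}"

definition neighbour :: "'a::euclidean_space \<Rightarrow> 'a set set \<Rightarrow> 'a set \<Rightarrow> 'a set \<Rightarrow> 'a set" where
  "neighbour per \<T> \<sigma> K = (THE L. is_common_edge per \<T> K L \<sigma>)"

text \<open>The last clause says that there are neither hanging nodes nor exterior edges: the torus has no
  boundary.\<close>

definition torus_mesh :: "'a::euclidean_space \<Rightarrow> 'a set set \<Rightarrow> bool" where
  "torus_mesh per \<T> \<longleftrightarrow>
     (\<forall>i\<in>Basis. 0 < per \<bullet> i) \<and>
     \<T> division_of (cbox 0 per) \<and>
     (\<forall>K\<in>\<T>. interior K \<noteq> {}) \<and>
     (\<forall>K\<in>\<T>. \<forall>L\<in>\<T>. K \<noteq> L \<longrightarrow> card {\<sigma>. is_common_edge per \<T> K L \<sigma>} \<le> 1) \<and>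
     (\<forall>K\<in>\<T>. edges K = int_edges per \<T> K)"


section \<open>Discrete operators\<close>

text \<open>A function that is constant on each cell is represented by its values on the cells.\<close>

definition cell_mean :: "('a::euclidean_space \<Rightarrow> 'b::euclidean_space) \<Rightarrow> 'a set \<Rightarrow> 'b" where
  "cell_mean q K = (1 / cell_measure K) *\<^sub>R (LINT x:K|lborel. q x)"

definition edge_vel ::
  "'a::euclidean_space \<Rightarrow> 'a set set \<Rightarrow> ('a set \<Rightarrow> 'a) \<Rightarrow> 'a set \<Rightarrow> 'a set \<Rightarrow> real" where
  "edge_vel per \<T> w \<sigma> K =
     (if \<sigma> \<in> int_edges per \<T> K
      then ((1/2) *\<^sub>R (w K + w (neighbour per \<T> \<sigma> K))) \<bullet> outer_normal \<sigma> K else 0)"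

definition grad_mesh ::
  "'a::euclidean_space \<Rightarrow> 'a set set \<Rightarrow> ('a set \<Rightarrow> real) \<Rightarrow> 'a set \<Rightarrow> 'a" where
  "grad_mesh per \<T> q K =
     (1 / cell_measure K) *\<^sub>R
       (\<Sum>\<sigma>\<in>int_edges per \<T> K.
          (edge_measure \<sigma> * ((q (neighbour per \<T> \<sigma> K) - q K) / 2)) *\<^sub>R outer_normal \<sigma> K)"

text \<open>The upwind divergence depends on the transporting velocity only through the nonnegative and
  nonpositive parts \<open>wp \<sigma> K\<close> and \<open>wm \<sigma> K\<close> of its normal component on the edges.\<close>

definition div_up ::
  "'a::euclidean_space \<Rightarrow> 'a set set \<Rightarrow> ('a set \<Rightarrow> 'b::real_vector) \<Rightarrow>
     ('a set \<Rightarrow> 'a set \<Rightarrow> real) \<Rightarrow> ('a set \<Rightarrow> 'a set \<Rightarrow> real) \<Rightarrow> 'a set \<Rightarrow> 'b" where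
  "div_up per \<T> q wp wm K =
     (1 / cell_measure K) *\<^sub>R
       (\<Sum>\<sigma>\<in>int_edges per \<T> K.
          edge_measure \<sigma> *\<^sub>R (wp \<sigma> K *\<^sub>R q K + wm \<sigma> K *\<^sub>R q (neighbour per \<T> \<sigma> K)))"

definition pos_part :: "real \<Rightarrow> real" where "pos_part a = (a + \<bar>a\<bar>) / 2"

definition neg_part :: "real \<Rightarrow> real" where "neg_part a = (a - \<bar>a\<bar>) / 2"

text \<open>The scheme splits the normal component of \<open>w = u - \<delta>u\<close> as follows; in general \<open>w_plus\<close> and
  \<open>w_minus\<close> are not the positive and negative parts of that component.\<close>

definition w_plus ::
  "'a::euclidean_space \<Rightarrow> 'a set set \<Rightarrow> ('a set \<Rightarrow> 'a) \<Rightarrow> ('a set \<Rightarrow> 'a) \<Rightarrow> 'a set \<Rightarrow> 'a set \<Rightarrow> real" where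
  "w_plus per \<T> u \<delta>u \<sigma> K = pos_part (edge_vel per \<T> u \<sigma> K) - neg_part (edge_vel per \<T> \<delta>u \<sigma> K)"

definition w_minus ::
  "'a::euclidean_space \<Rightarrow> 'a set set \<Rightarrow> ('a set \<Rightarrow> 'a) \<Rightarrow> ('a set \<Rightarrow> 'a) \<Rightarrow> 'a set \<Rightarrow> 'a set \<Rightarrow> real" where
  "w_minus per \<T> u \<delta>u \<sigma> K = neg_part (edge_vel per \<T> u \<sigma> K) - pos_part (edge_vel per \<T> \<delta>u \<sigma> K)"

lemma w_splitting:
  "w_plus per \<T> u \<delta>u \<sigma> K + w_minus per \<T> u \<delta>u \<sigma> K = edge_vel per \<T> (\<lambda>K. u K - \<delta>u K) \<sigma> K"
  "0 \<le> w_plus per \<T> u \<delta>u \<sigma> K" "w_minus per \<T> u \<delta>u \<sigma> K \<le> 0"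
  by (auto simp: w_plus_def w_minus_def pos_part_def neg_part_def edge_vel_def
      inner_add_left inner_diff_left field_simps)


section \<open>The scheme\<close>

definition pressure :: "real \<Rightarrow> real \<Rightarrow> real" where
  "pressure \<gamma> r = r powr \<gamma>"

definition psi :: "real \<Rightarrow> real \<Rightarrow> real" where
  "psi \<gamma> r = r powr \<gamma> / (\<gamma> - 1)"

definition rel_psi :: "real \<Rightarrow> real \<Rightarrow> real" where
  "rel_psi \<gamma> r = psi \<gamma> r - psi \<gamma> 1 - deriv (psi \<gamma>) 1 * (r - 1)"

definition energy ::
  "'a::euclidean_space set set \<Rightarrow> real \<Rightarrow> real \<Rightarrow> ('a set \<Rightarrow> real) \<Rightarrow> ('a set \<Rightarrow> 'a) \<Rightarrow> real" where
  "energy \<T> \<gamma> \<epsilon> \<rho> u =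
     (\<Sum>K\<in>\<T>. cell_measure K * (1/2 * \<rho> K * (norm (u K))\<^sup>2 + 1/\<epsilon>\<^sup>2 * rel_psi \<gamma> (\<rho> K)))"

definition initial_data ::
  "'a::euclidean_space \<Rightarrow> ('a \<Rightarrow> real) \<Rightarrow> ('a \<Rightarrow> 'a) \<Rightarrow> bool" where
  "initial_data per \<rho>0 u0 \<longleftrightarrow>
     periodic per \<rho>0 \<and> periodic per u0 \<and>
     set_integrable lborel (cbox 0 per) \<rho>0 \<and> set_integrable lborel (cbox 0 per) u0 \<and>
     (\<forall>x. 0 < \<rho>0 x)"

definition grad_p ::
  "'a::euclidean_space \<Rightarrow> 'a set set \<Rightarrow> real \<Rightarrow> ('a set \<Rightarrow> real) \<Rightarrow> 'a set \<Rightarrow> 'a" where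
  "grad_p per \<T> \<gamma> \<rho> = grad_mesh per \<T> (\<lambda>K. pressure \<gamma> (\<rho> K))"

definition vel_shift ::
  "'a::euclidean_space \<Rightarrow> 'a set set \<Rightarrow> real \<Rightarrow> real \<Rightarrow> real \<Rightarrow> real \<Rightarrow> ('a set \<Rightarrow> real) \<Rightarrow> 'a set \<Rightarrow> 'a" where
  "vel_shift per \<T> \<gamma> \<epsilon> \<eta> \<delta>t \<rho> K = (\<eta> * \<delta>t / \<epsilon>\<^sup>2) *\<^sub>R grad_p per \<T> \<gamma> \<rho> K"

definition discrete_solution ::
  "'a::euclidean_space \<Rightarrow> 'a set set \<Rightarrow> real \<Rightarrow> real \<Rightarrow> real \<Rightarrow> real \<Rightarrow> nat \<Rightarrow>
     ('a \<Rightarrow> real) \<Rightarrow> ('a \<Rightarrow> 'a) \<Rightarrow> (nat \<Rightarrow> 'a set \<Rightarrow> real) \<Rightarrow> (nat \<Rightarrow> 'a set \<Rightarrow> 'a) \<Rightarrow> bool" where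
  "discrete_solution per \<T> \<gamma> \<epsilon> \<eta> \<delta>t N \<rho>0 u0 \<rho> u \<longleftrightarrow>
     (\<forall>K\<in>\<T>. \<rho> 0 K = cell_mean \<rho>0 K \<and> u 0 K = cell_mean u0 K) \<and>
     (\<forall>n\<le>N. \<forall>K\<in>\<T>. 0 < \<rho> n K) \<and>
     (\<forall>n<N. \<forall>K\<in>\<T>.
        let \<delta>u = vel_shift per \<T> \<gamma> \<epsilon> \<eta> \<delta>t (\<rho> (Suc n));
            wp = w_plus per \<T> (u n) \<delta>u;
            wm = w_minus per \<T> (u n) \<delta>u
        in (\<rho> (Suc n) K - \<rho> n K) / \<delta>t + div_up per \<T> (\<rho> (Suc n)) wp wm K = 0 \<and>
           (1 / \<delta>t) *\<^sub>R (\<rho> (Suc n) K *\<^sub>R u (Suc n) K - \<rho> n K *\<^sub>R u n K)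
             + div_up per \<T> (\<lambda>L. \<rho> (Suc n) L *\<^sub>R u n L) wp wm K
             + (1 / \<epsilon>\<^sup>2) *\<^sub>R grad_p per \<T> \<gamma> (\<rho> (Suc n)) K = 0)"

text \<open>The sum in the denominator of the time-step restriction.\<close>

definition inflow ::
  "'a::euclidean_space \<Rightarrow> 'a set set \<Rightarrow> real \<Rightarrow> real \<Rightarrow> real \<Rightarrow> real \<Rightarrow>
     ('a set \<Rightarrow> real) \<Rightarrow> ('a set \<Rightarrow> 'a) \<Rightarrow> 'a set \<Rightarrow> real" where
  "inflow per \<T> \<gamma> \<epsilon> \<eta> \<delta>t \<rho>' u K =
     (\<Sum>\<sigma>\<in>int_edges per \<T> K.
        edge_measure \<sigma> * \<rho>' (neighbour per \<T> \<sigma> K)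
          * (- w_minus per \<T> u (vel_shift per \<T> \<gamma> \<epsilon> \<eta> \<delta>t \<rho>') \<sigma> K))"

text \<open>A vanishing denominator means that the time step is not restricted.\<close>

definition time_step_condition ::
  "'a::euclidean_space \<Rightarrow> 'a set set \<Rightarrow> real \<Rightarrow> real \<Rightarrow> real \<Rightarrow> real \<Rightarrow> nat \<Rightarrow>
     (nat \<Rightarrow> 'a set \<Rightarrow> real) \<Rightarrow> (nat \<Rightarrow> 'a set \<Rightarrow> 'a) \<Rightarrow> bool" where
  "time_step_condition per \<T> \<gamma> \<epsilon> \<eta> \<delta>t N \<rho> u \<longleftrightarrow>
     (\<forall>n<N. \<forall>K\<in>\<T>.
        let S = inflow per \<T> \<gamma> \<epsilon> \<eta> \<delta>t (\<rho> (Suc n)) (u n) K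
        in S \<noteq> 0 \<longrightarrow> \<delta>t \<le> cell_measure K * \<rho> (Suc n) K / (2 * S))"

end

theory Submission
  imports Defs
begin

text \<open>Subtracting \<open>u\<^sub>K\<close> times the mass balance from the momentum balance and multiplying by \<open>u\<^sub>K\<close> gives a
  kinetic energy balance. Its explicit-in-time error \<open>|u\<^sup>n\<^sup>+\<^sup>1 - u\<^sup>n|\<^sup>2\<close> splits into a transport part, which the upwind
  dissipation absorbs under the time-step restriction, and a pressure part
  \<open>\<delta>t\<^sup>2 |\<nabla>p|\<^sup>2 / (\<epsilon>\<^sup>4 \<rho>)\<close>. Multiplying the mass balance by \<open>\<psi>'(\<rho>\<^sub>K)\<close> bounds the internal energy by the
  pressure work against \<open>w = u - \<delta>u\<close>, by convexity of \<open>\<psi>\<close> and \<open>r \<psi>'(r) - \<psi>(r) = p(r)\<close>. In the sum the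
  pressure work against \<open>u\<close> cancels, while the work against \<open>\<delta>u\<close> contributes
  \<open>- \<eta> \<delta>t\<^sup>2 |\<nabla>p|\<^sup>2 / \<epsilon>\<^sup>4\<close> and dominates the pressure part because \<open>\<eta> > 1 / \<rho>\<close>. All fluxes cancel because
  \<open>(K, v) \<mapsto> (neighbour of K across its face with normal v, - v)\<close> is an involution on the pairs of a cell
  and an outer normal.\<close>

section \<open>Faces of a periodic mesh\<close>

lemma uminus_axis_normals: "v \<in> axis_normals \<Longrightarrow> - v \<in> axis_normals"
  by (auto simp: axis_normals_def)

lemma uminus_Basis_neq:
  fixes i j :: "'a::euclidean_space"
  assumes "i \<in> Basis" "j \<in> Basis"
  shows "i \<noteq> - j"
proof
  assume e: "i = - j"
  have "i \<bullet> j = - 1" unfolding e by (simp add: assms)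
  moreover have "i \<bullet> j = 0 \<or> i \<bullet> j = 1" by (metis inner_Basis assms)
  ultimately show False by linarith
qed

text \<open>A face of a box is again a box, degenerate in one direction; \<open>face_lower\<close>
  and \<open>face_upper\<close> are its corners. For \<open>v = i\<close> the lower corner is pushed
  up to \<open>b\<close>, for \<open>v = - i\<close> the upper one is pushed down to
  \<open>a\<close>.\<close>

definition face_lower :: "'a::euclidean_space \<Rightarrow> 'a \<Rightarrow> 'a \<Rightarrow> 'a" where
  "face_lower a b v = (\<Sum>i\<in>Basis. (if v = i then b \<bullet> i else a \<bullet> i) *\<^sub>R i)"

definition face_upper :: "'a::euclidean_space \<Rightarrow> 'a \<Rightarrow> 'a \<Rightarrow> 'a" where
  "face_upper a b v = (\<Sum>i\<in>Basis. (if v = - i then a \<bullet> i else b \<bullet> i) *\<^sub>R i)"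

lemma face_lower_inner [simp]:
  "i \<in> Basis \<Longrightarrow> face_lower a b v \<bullet> i = (if v = i then b \<bullet> i else a \<bullet> i)"
  by (simp add: face_lower_def)

lemma face_upper_inner [simp]:
  "i \<in> Basis \<Longrightarrow> face_upper a b v \<bullet> i = (if v = - i then a \<bullet> i else b \<bullet> i)"
  by (simp add: face_upper_def)

text \<open>The functional of an axis direction is maximal exactly where that coordinate is extreme;
  the corner \<open>b\<close> (for \<open>v = i\<close>) or \<open>a\<close> (for
  \<open>v = - i\<close>) shows that the extreme value is attained.\<close>

lemma face_cbox:
  fixes a b v :: "'a::euclidean_space"
  assumes v: "v \<in> axis_normals" and ab: "\<And>i. i \<in> Basis \<Longrightarrow> a \<bullet> i < b \<bullet> i"
  shows "face (cbox a b) v = cbox (face_lower a b v) (face_upper a b v)"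
proof -
  have corner: "a \<in> cbox a b" "b \<in> cbox a b"
    using ab by (auto simp: mem_box less_imp_le)
  consider (pos) i where "i \<in> Basis" "v = i" | (neg) i where "i \<in> Basis" "v = - i"
    using v by (auto simp: axis_normals_def)
  then show ?thesis
  proof cases
    case pos
    have "x \<in> face (cbox a b) v \<longleftrightarrow> x \<in> cbox a b \<and> b \<bullet> i \<le> x \<bullet> i" for x
    proof
      assume "x \<in> face (cbox a b) v"
      then show "x \<in> cbox a b \<and> b \<bullet> i \<le> x \<bullet> i"
        using corner(2) pos(2) by (simp add: face_def)
    next
      assume "x \<in> cbox a b \<and> b \<bullet> i \<le> x \<bullet> i"
      moreover have "y \<bullet> i \<le> b \<bullet> i" if "y \<in> cbox a b" for y
        using that pos(1) by (simp add: mem_box)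
      ultimately show "x \<in> face (cbox a b) v"
        using pos(2) order_trans unfolding face_def by blast
    qed
    moreover have "x \<in> cbox (face_lower a b v) (face_upper a b v) \<longleftrightarrow>
        (\<forall>j\<in>Basis. (if i = j then b \<bullet> j else a \<bullet> j) \<le> x \<bullet> j \<and> x \<bullet> j \<le> b \<bullet> j)" for x
      unfolding mem_box pos(2)
      by (intro ball_cong refl) (simp only: face_lower_inner face_upper_inner
          uminus_Basis_neq[OF pos(1)] if_False)
    moreover have "(\<forall>j\<in>Basis. (if i = j then b \<bullet> j else a \<bullet> j) \<le> x \<bullet> j \<and> x \<bullet> j \<le> b \<bullet> j) \<longleftrightarrow>
        x \<in> cbox a b \<and> b \<bullet> i \<le> x \<bullet> i" for x
      unfolding mem_box using pos(1) ab[OF pos(1)] by force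
    ultimately show ?thesis by blast
  next
    case neg
    have "x \<in> face (cbox a b) v \<longleftrightarrow> x \<in> cbox a b \<and> x \<bullet> i \<le> a \<bullet> i" for x
    proof
      assume "x \<in> face (cbox a b) v"
      then show "x \<in> cbox a b \<and> x \<bullet> i \<le> a \<bullet> i"
        using corner(1) neg(2) by (simp add: face_def)
    next
      assume x: "x \<in> cbox a b \<and> x \<bullet> i \<le> a \<bullet> i"
      have "y \<bullet> v \<le> x \<bullet> v" if "y \<in> cbox a b" for y
      proof -
        have "a \<bullet> i \<le> y \<bullet> i" using that neg(1) by (simp add: mem_box)
        then show ?thesis using x neg(2) by simp
      qed
      then show "x \<in> face (cbox a b) v"
        using x unfolding face_def by blast
    qed
    moreover have "x \<in> cbox (face_lower a b v) (face_upper a b v) \<longleftrightarrow>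
        (\<forall>j\<in>Basis. a \<bullet> j \<le> x \<bullet> j \<and> x \<bullet> j \<le> (if i = j then a \<bullet> j else b \<bullet> j))" for x
      unfolding mem_box neg(2)
      by (intro ball_cong refl) (simp only: face_lower_inner face_upper_inner
          uminus_Basis_neq[OF _ neg(1), symmetric] neg_equal_iff_equal if_False)
    moreover have "(\<forall>j\<in>Basis. a \<bullet> j \<le> x \<bullet> j \<and> x \<bullet> j \<le> (if i = j then a \<bullet> j else b \<bullet> j)) \<longleftrightarrow>
        x \<in> cbox a b \<and> x \<bullet> i \<le> a \<bullet> i" for x
      unfolding mem_box using neg(1) ab[OF neg(1)] by force
    ultimately show ?thesis by blast
  qed
qed

text \<open>Only for nonempty boxes does equality of the sets give equality of the corners; this is
  what allows corners of faces to be compared below.\<close>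

lemma face_cbox_ne:
  fixes a b v :: "'a::euclidean_space"
  assumes ab: "\<And>i. i \<in> Basis \<Longrightarrow> a \<bullet> i < b \<bullet> i"
  shows "cbox (face_lower a b v) (face_upper a b v) \<noteq> {}"
  unfolding box_ne_empty
proof
  fix i :: 'a
  assume i: "i \<in> Basis"
  then have "i \<noteq> - i" by (intro uminus_Basis_neq)
  then show "face_lower a b v \<bullet> i \<le> face_upper a b v \<bullet> i"
    using i ab[OF i] by auto
qed

text \<open>Being constant in a coordinate survives translation, so the axis is the same. Only the
  other coordinates enter the measure, and a shift along the axis leaves the projected set
  unchanged.\<close>

lemma edge_measure_translation:
  fixes z :: "'a::euclidean_space"
  assumes z: "\<And>j. j \<in> Basis \<Longrightarrow> j \<noteq> edge_axis \<sigma> \<Longrightarrow> z \<bullet> j = 0"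
  shows "edge_measure ((+) z ` \<sigma>) = edge_measure \<sigma>"
proof -
  have "(\<exists>c. \<forall>x\<in>(+) z ` \<sigma>. x \<bullet> i = c) \<longleftrightarrow> (\<exists>c. \<forall>x\<in>\<sigma>. x \<bullet> i = c)" for i
  proof
    assume "\<exists>c. \<forall>x\<in>(+) z ` \<sigma>. x \<bullet> i = c"
    then obtain c where "\<forall>x\<in>\<sigma>. (z + x) \<bullet> i = c" by auto
    then have "\<forall>x\<in>\<sigma>. x \<bullet> i = c - z \<bullet> i" by (auto simp: inner_add_left)
    then show "\<exists>c. \<forall>x\<in>\<sigma>. x \<bullet> i = c" ..
  qed (auto simp: inner_add_left)
  then have axis: "edge_axis ((+) z ` \<sigma>) = edge_axis \<sigma>"
    by (simp only: edge_axis_def)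
  have "(\<lambda>i\<in>Basis - {edge_axis \<sigma>}. (z + x) \<bullet> i) = (\<lambda>i\<in>Basis - {edge_axis \<sigma>}. x \<bullet> i)" for x
    using z by (auto simp: inner_add_left)
  then show ?thesis
    by (simp add: edge_measure_def axis image_image)
qed

text \<open>The two corners of the face agree in the direction of its normal and differ in all
  others, because \<open>a\<close> lies strictly below \<open>b\<close>. Hence the axis in
  \<open>edge_axis_def\<close> is unique.\<close>

lemma edge_axis_face:
  fixes a b v :: "'a::euclidean_space"
  assumes v: "v = i \<or> v = - i" and i: "i \<in> Basis"
    and ab: "\<And>i. i \<in> Basis \<Longrightarrow> a \<bullet> i < b \<bullet> i"
  shows "edge_axis (face (cbox a b) v) = i"
proof -
  let ?l = "face_lower a b v" and ?u = "face_upper a b v"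
  have nv: "v \<in> axis_normals" using v i by (auto simp: axis_normals_def)
  have eq: "face (cbox a b) v = cbox ?l ?u" by (rule face_cbox[OF nv ab])
  have "?l \<in> cbox ?l ?u" "?u \<in> cbox ?l ?u"
    using face_cbox_ne[OF ab, of v] by (auto simp: mem_box box_ne_empty)
  show ?thesis
    unfolding edge_axis_def eq
  proof (rule the_equality)
    have "x \<bullet> i = ?l \<bullet> i" if "x \<in> cbox ?l ?u" for x
      using that v i uminus_Basis_neq[OF i i] by (force simp: mem_box split: if_splits)
    then show "i \<in> Basis \<and> (\<exists>c. \<forall>x\<in>cbox ?l ?u. x \<bullet> i = c)" using i by blast
  next
    fix j assume j: "j \<in> Basis \<and> (\<exists>c. \<forall>x\<in>cbox ?l ?u. x \<bullet> j = c)"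
    then have "?l \<bullet> j = ?u \<bullet> j"
      using \<open>?l \<in> cbox ?l ?u\<close> \<open>?u \<in> cbox ?l ?u\<close> by metis
    then show "j = i"
      using j ab[of j] v uminus_Basis_neq[of j i] uminus_Basis_neq[of i j] i
      by (auto split: if_splits)
  qed
qed

section \<open>Gluing of cell faces on the torus\<close>

locale periodic_mesh =
  fixes per :: "'a::euclidean_space" and \<T> :: "'a set set"
  assumes mesh: "torus_mesh per \<T>"
begin

lemma per_pos: "i \<in> Basis \<Longrightarrow> 0 < per \<bullet> i"
  using mesh by (simp add: torus_mesh_def)

lemma cell_cbox:
  assumes "K \<in> \<T>"
  obtains a b where "K = cbox a b" "\<And>i. i \<in> Basis \<Longrightarrow> a \<bullet> i < b \<bullet> i"
    "\<And>i. i \<in> Basis \<Longrightarrow> 0 \<le> a \<bullet> i" "\<And>i. i \<in> Basis \<Longrightarrow> b \<bullet> i \<le> per \<bullet> i"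
proof -
  have div: "\<T> division_of cbox 0 per" and int: "interior K \<noteq> {}"
    using mesh assms by (auto simp: torus_mesh_def)
  obtain a b where K: "K = cbox a b" using division_ofD(4)[OF div assms] by blast
  have lt: "a \<bullet> i < b \<bullet> i" if "i \<in> Basis" for i
    using int that by (auto simp: K box_ne_empty)
  have "cbox a b \<subseteq> cbox 0 per" using division_ofD(2)[OF div assms] by (simp add: K)
  then have "0 \<le> a \<bullet> i \<and> b \<bullet> i \<le> per \<bullet> i" if "i \<in> Basis" for i
    using lt that by (fastforce simp: subset_box)
  then show thesis using that K lt by blast
qed

lemma cell_measure_pos: "K \<in> \<T> \<Longrightarrow> 0 < cell_measure K"
  by (erule cell_cbox) (simp add: content_pos_lt_eq)

lemma overlapping_cells:
  assumes "K \<in> \<T>" "L \<in> \<T>" "interior K \<inter> interior L \<noteq> {}"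
  shows "K = L"
proof -
  have "\<T> division_of cbox 0 per" using mesh by (simp add: torus_mesh_def)
  from division_ofD(5)[OF this] assms show ?thesis by blast
qed

text \<open>Both cells lie in the fundamental box, so tangentially the translation is shorter than a
  period and hence zero. Faces on the same side of both cells then make the cells overlap; otherwise
  the normals are opposite, and a shift by a period along the normal is possible.\<close>

lemma translated_face:
  assumes K: "K \<in> \<T>" and L: "L \<in> \<T>" and v: "v \<in> axis_normals" and w: "w \<in> axis_normals"
    and z: "z \<in> lattice per" and eq: "face L w = (+) z ` face K v"
  shows "w = v \<and> L = K \<or> w = - v" "edge_measure (face L w) = edge_measure (face K v)"
proof -
  obtain a b where ab: "K = cbox a b" "\<And>i. i \<in> Basis \<Longrightarrow> a \<bullet> i < b \<bullet> i"
    "\<And>i. i \<in> Basis \<Longrightarrow> 0 \<le> a \<bullet> i" "\<And>i. i \<in> Basis \<Longrightarrow> b \<bullet> i \<le> per \<bullet> i"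
    using cell_cbox[OF K] by blast
  obtain c d where cd: "L = cbox c d" "\<And>i. i \<in> Basis \<Longrightarrow> c \<bullet> i < d \<bullet> i"
    "\<And>i. i \<in> Basis \<Longrightarrow> 0 \<le> c \<bullet> i" "\<And>i. i \<in> Basis \<Longrightarrow> d \<bullet> i \<le> per \<bullet> i"
    using cell_cbox[OF L] by blast
  have "cbox (face_lower c d w) (face_upper c d w)
      = cbox (z + face_lower a b v) (z + face_upper a b v)"
    using eq face_cbox[OF v ab(2)] face_cbox[OF w cd(2)] by (simp add: ab(1) cd(1) cbox_translation)
  then have corners: "face_lower c d w = z + face_lower a b v"
    "face_upper c d w = z + face_upper a b v"
    using face_cbox_ne[OF cd(2), of w] by (auto simp: eq_cbox)
  have lo: "(if w = j then d \<bullet> j else c \<bullet> j) = z \<bullet> j + (if v = j then b \<bullet> j else a \<bullet> j)"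
    if "j \<in> Basis" for j
    using arg_cong[OF corners(1), of "\<lambda>x. x \<bullet> j"] that by (simp add: inner_add_left)
  have up: "(if w = - j then c \<bullet> j else d \<bullet> j) = z \<bullet> j + (if v = - j then a \<bullet> j else b \<bullet> j)"
    if "j \<in> Basis" for j
    using arg_cong[OF corners(2), of "\<lambda>x. x \<bullet> j"] that by (simp add: inner_add_left)
  obtain i where i: "i \<in> Basis" "v = i \<or> v = - i"
    using v by (auto simp: axis_normals_def)
  \<comment> \<open>The face is degenerate along \<open>i\<close>, while \<open>c\<close> lies
    strictly below \<open>d\<close>; so \<open>w\<close> has to point along the same axis.\<close>
  have w_i: "w = i \<or> w = - i"
    using lo[OF i(1)] up[OF i(1)] i(2) cd(2)[OF i(1)] uminus_Basis_neq[OF i(1) i(1)]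
    by (auto split: if_splits)
  have small: "z \<bullet> j = 0" if j: "j \<in> Basis" and "\<bar>z \<bullet> j\<bar> < per \<bullet> j" for j
  proof -
    obtain k :: int where k: "z \<bullet> j = of_int k * (per \<bullet> j)"
      using z j by (auto simp: lattice_def)
    have "\<bar>real_of_int k\<bar> < 1"
      using that(2) per_pos[OF j] by (simp add: k abs_mult)
    then have "k = 0" by linarith
    then show ?thesis by (simp add: k)
  qed
  have tang: "z \<bullet> j = 0 \<and> c \<bullet> j = a \<bullet> j \<and> d \<bullet> j = b \<bullet> j" if j: "j \<in> Basis" "j \<noteq> i" for j
  proof -
    have ne: "v \<noteq> j" "v \<noteq> - j" "w \<noteq> j" "w \<noteq> - j"
      using i w_i j uminus_Basis_neq[OF i(1) j(1)] uminus_Basis_neq[OF j(1) i(1)] by auto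
    have "c \<bullet> j = z \<bullet> j + a \<bullet> j" "d \<bullet> j = z \<bullet> j + b \<bullet> j"
      using lo[OF j(1)] up[OF j(1)] ne by auto
    then show ?thesis
      using ab(2-4)[OF j(1)] cd(2-4)[OF j(1)] small[OF j(1)] by auto
  qed
  show "edge_measure (face L w) = edge_measure (face K v)"
    unfolding eq
    by (rule edge_measure_translation)
      (use tang edge_axis_face[OF i(2,1) ab(2)] ab(1) in auto)
  \<comment> \<open>For equal normals the shift along \<open>i\<close> is also shorter than a
    period. The cells share one bound in direction \<open>i\<close> and both bounds in the others,
    so their interiors meet.\<close>
  have same: "L = K" if "w = v"
  proof -
    have normal: "c \<bullet> i = a \<bullet> i \<or> d \<bullet> i = b \<bullet> i"
      using lo[OF i(1)] up[OF i(1)] i that uminus_Basis_neq[OF i(1) i(1)]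
        ab(2-4)[OF i(1)] cd(2-4)[OF i(1)] small[OF i(1)]
      by (auto split: if_splits)
    have "interior L \<inter> interior K \<noteq> {}"
      unfolding ab(1) cd(1) interior_cbox disjoint_interval
      using tang normal ab(2) cd(2) i by (metis not_less)
    then show ?thesis using overlapping_cells K L by blast
  qed
  show "w = v \<and> L = K \<or> w = - v" using same i w_i by auto
qed

lemma zero_in_lattice: "0 \<in> lattice per"
  by (auto simp: lattice_def intro!: exI[of _ "0::int"])

lemma lattice_diff: "x \<in> lattice per \<Longrightarrow> y \<in> lattice per \<Longrightarrow> x - y \<in> lattice per"
  unfolding lattice_def mem_Collect_eq inner_diff_left
  by (metis left_diff_distrib of_int_diff)

text \<open>By \<open>translated_face\<close> with the zero translation, only opposite normals could
  give the same face, but opposite faces of a cell of positive width have different lower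
  corners.\<close>

lemma face_inj:
  assumes K: "K \<in> \<T>" and v: "v \<in> axis_normals" and w: "w \<in> axis_normals"
    and eq: "face K w = face K v"
  shows "w = v"
proof (rule ccontr)
  assume "w \<noteq> v"
  with translated_face(1)[OF K K v w zero_in_lattice] eq have w_v: "w = - v" by auto
  obtain a b where ab: "K = cbox a b" "\<And>i. i \<in> Basis \<Longrightarrow> a \<bullet> i < b \<bullet> i"
    using cell_cbox[OF K] by blast
  obtain i where i: "i \<in> Basis" "v = i \<or> v = - i"
    using v by (auto simp: axis_normals_def)
  have "face_lower a b w = face_lower a b v"
    using eq face_cbox_ne[OF ab(2)]
    by (simp add: ab(1) face_cbox[OF v ab(2)] face_cbox[OF w ab(2)] eq_cbox)
  then have "face_lower a b w \<bullet> i = face_lower a b v \<bullet> i" by simp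
  then show False
    using i w_v ab(2)[OF i(1)] uminus_Basis_neq[OF i(1) i(1)] by (auto split: if_splits)
qed

lemma outer_normal_face:
  assumes "K \<in> \<T>" "v \<in> axis_normals"
  shows "outer_normal (face K v) K = v"
  unfolding outer_normal_def
proof (rule the_equality)
  show "w = v" if "w \<in> axis_normals \<and> face K v = face K w" for w
    using face_inj[OF assms, of w] that by simp
qed (simp add: assms)

text \<open>As the cells are distinct, only the alternative of opposite normals in
  \<open>translated_face\<close> remains, which determines the face of \<open>L\<close> that takes
  part.\<close>

lemma common_edge_opposite:
  assumes e: "is_common_edge per \<T> K L (face K v)" and v: "v \<in> axis_normals"
  obtains z where "z \<in> lattice per" "face L (- v) = (+) z ` face K v"
    "edge_measure (face L (- v)) = edge_measure (face K v)"
proof -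
  from e have KL: "K \<in> \<T>" "L \<in> \<T>" "L \<noteq> K" unfolding is_common_edge_def by blast+
  from e obtain w z where w: "w \<in> axis_normals" "z \<in> lattice per" "face L w = (+) z ` face K v"
    unfolding is_common_edge_def edges_def same_edge_def by blast
  have "w = - v" using translated_face(1)[OF KL(1,2) v w] KL(3) by argo
  then show thesis using that[OF w(2)] w(3) translated_face(2)[OF KL(1,2) v w] by simp
qed

text \<open>Both neighbours meet the edge with normal \<open>- v\<close>, and the difference of the
  two translations maps one of these faces to the other. Faces with equal normals belong to the same
  cell.\<close>

lemma common_edge_unique:
  assumes e: "is_common_edge per \<T> K L (face K v)" and f: "is_common_edge per \<T> K M (face K v)"
    and v: "v \<in> axis_normals"
  shows "M = L"
proof -
  from e f have LM: "L \<in> \<T>" "M \<in> \<T>" unfolding is_common_edge_def by blast+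
  obtain y where y: "y \<in> lattice per" "face L (- v) = (+) y ` face K v"
    by (rule common_edge_opposite[OF e v])
  obtain z where z: "z \<in> lattice per" "face M (- v) = (+) z ` face K v"
    by (rule common_edge_opposite[OF f v])
  have "face M (- v) = (+) (z - y) ` face L (- v)"
    by (simp add: y z image_image)
  from translated_face(1)[OF LM uminus_axis_normals[OF v] uminus_axis_normals[OF v]
      lattice_diff[OF z(1) y(1)] this]
  have "M = L \<or> v = - v" by auto
  moreover have "v \<noteq> - v"
    using v uminus_Basis_neq unfolding axis_normals_def by force
  ultimately show ?thesis by blast
qed

text \<open>Addressing an edge by its outer normal instead of as a set relates the two
  representatives of a glued edge: it is \<open>v\<close> from one side and \<open>- v\<close> from
  the other.\<close>

definition nb :: "'a set \<Rightarrow> 'a \<Rightarrow> 'a set" where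
  "nb K v = neighbour per \<T> (face K v) K"

lemma int_edges_eq:
  assumes "K \<in> \<T>"
  shows "int_edges per \<T> K = face K ` axis_normals"
  using mesh assms by (auto simp: torus_mesh_def edges_def)

lemma common_edge_nb:
  assumes K: "K \<in> \<T>" and v: "v \<in> axis_normals"
  shows "is_common_edge per \<T> K (nb K v) (face K v)"
proof -
  have "face K v \<in> int_edges per \<T> K" using int_edges_eq[OF K] v by blast
  then obtain L where L: "is_common_edge per \<T> K L (face K v)" by (auto simp: int_edges_def)
  then have "nb K v = L"
    unfolding nb_def neighbour_def by (rule the_equality) (rule common_edge_unique[OF L _ v])
  then show ?thesis using L by simp
qed

lemma nb_in: "K \<in> \<T> \<Longrightarrow> v \<in> axis_normals \<Longrightarrow> nb K v \<in> \<T>"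
  using common_edge_nb unfolding is_common_edge_def by blast

lemma edge_measure_nb:
  assumes "K \<in> \<T>" "v \<in> axis_normals"
  shows "edge_measure (face (nb K v) (- v)) = edge_measure (face K v)"
  by (rule common_edge_opposite[OF common_edge_nb[OF assms] assms(2)])

text \<open>Sharing an edge is symmetric because the lattice is closed under negation; uniqueness of
  the neighbour then leads back to \<open>K\<close>.\<close>

lemma nb_nb:
  assumes K: "K \<in> \<T>" and v: "v \<in> axis_normals"
  shows "nb (nb K v) (- v) = K"
proof -
  let ?L = "nb K v"
  note e = common_edge_nb[OF K v]
  obtain z where z: "z \<in> lattice per" "face ?L (- v) = (+) z ` face K v"
    by (rule common_edge_opposite[OF e v])
  have "face K v = (+) (- z) ` face ?L (- v)" by (simp add: z image_image)
  moreover have "- z \<in> lattice per" using lattice_diff[OF zero_in_lattice z(1)] by simp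
  ultimately have "same_edge per (face ?L (- v)) (face K v)"
    unfolding same_edge_def by blast
  then have "is_common_edge per \<T> ?L K (face ?L (- v))"
    using e v uminus_axis_normals[OF v] unfolding is_common_edge_def edges_def by blast
  then show ?thesis
    using common_edge_unique[OF _ common_edge_nb[OF nb_in[OF K v] uminus_axis_normals[OF v]]]
      uminus_axis_normals[OF v] by blast
qed

lemma sum_int_edges:
  assumes "K \<in> \<T>"
  shows "(\<Sum>\<sigma>\<in>int_edges per \<T> K. F \<sigma>) = (\<Sum>v\<in>axis_normals. F (face K v))"
  unfolding int_edges_eq[OF assms]
  by (rule sum.reindex_cong[of "face K"]) (auto intro: inj_onI face_inj[OF assms])

text \<open>By \<open>nb_nb\<close> the reindexing map is its own inverse; it visits every edge from
  its other side.\<close>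

lemma sum_nb:
  "(\<Sum>K\<in>\<T>. \<Sum>v\<in>axis_normals. F K v) = (\<Sum>K\<in>\<T>. \<Sum>v\<in>axis_normals. F (nb K v) (- v))"
  unfolding sum.cartesian_product
  by (rule sum.reindex_bij_witness[where i = "\<lambda>(K, v). (nb K v, - v)" and j = "\<lambda>(K, v). (nb K v, - v)"])
    (auto simp: nb_nb nb_in uminus_axis_normals)

end

section \<open>Energy balance\<close>

text \<open>Cauchy-Schwarz after writing each weight as a product of two square roots.\<close>

lemma norm_weighted_sum_le:
  fixes d :: "'b \<Rightarrow> 'a::real_inner"
  assumes c: "\<And>i. i \<in> I \<Longrightarrow> 0 \<le> c i"
  shows "(norm (\<Sum>i\<in>I. c i *\<^sub>R d i))\<^sup>2 \<le> (\<Sum>i\<in>I. c i) * (\<Sum>i\<in>I. c i * (norm (d i))\<^sup>2)"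
proof -
  have "norm (\<Sum>i\<in>I. c i *\<^sub>R d i) \<le> (\<Sum>i\<in>I. sqrt (c i) * (sqrt (c i) * norm (d i)))"
    by (rule sum_norm_le) (use c in \<open>simp flip: mult.assoc\<close>)
  then have "(norm (\<Sum>i\<in>I. c i *\<^sub>R d i))\<^sup>2 \<le> (\<Sum>i\<in>I. sqrt (c i) * (sqrt (c i) * norm (d i)))\<^sup>2"
    by (simp add: power_mono)
  also have "\<dots> \<le> (\<Sum>i\<in>I. (sqrt (c i))\<^sup>2) * (\<Sum>i\<in>I. (sqrt (c i) * norm (d i))\<^sup>2)"
    by (rule Cauchy_Schwarz_ineq_sum)
  also have "\<dots> = (\<Sum>i\<in>I. c i) * (\<Sum>i\<in>I. c i * (norm (d i))\<^sup>2)"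
    using c by (simp add: power_mult_distrib)
  finally show ?thesis .
qed

text \<open>Parallelogram law with the square of \<open>x + y\<close> dropped.\<close>

lemma norm_diff_squared_le:
  fixes x y :: "'a::real_inner"
  shows "(norm (x - y))\<^sup>2 \<le> 2 * (norm x)\<^sup>2 + 2 * (norm y)\<^sup>2"
  using zero_le_power2[of "norm (x + y)"]
  by (simp add: power2_norm_eq_inner algebra_simps inner_commute)

text \<open>The balance of one cell in abstract form: \<open>U\<close> and \<open>U'\<close> are the
  old and new velocity, \<open>W\<close> the neighbouring velocities, \<open>c\<close> the inflow
  weights, \<open>G\<close> the pressure gradient and \<open>e\<close> the square of the Mach
  number. Testing with the old velocity \<open>U\<close> leaves the square of the jump as an
  error.\<close>

lemma explicit_step_kinetic_energy:
  fixes U U' G :: "'a::real_inner"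
  assumes pos: "0 < M" "0 < \<tau>" "0 < r" "0 < e"
    and c: "\<And>i. i \<in> I \<Longrightarrow> 0 \<le> c i"
    and step: "(M * r / \<tau>) *\<^sub>R (U' - U) = (\<Sum>i\<in>I. c i *\<^sub>R (W i - U)) - (M / e) *\<^sub>R G"
    and cfl: "(\<Sum>i\<in>I. c i) \<noteq> 0 \<Longrightarrow> \<tau> \<le> M * r / (2 * (\<Sum>i\<in>I. c i))"
  shows "(M * r / \<tau>) * ((norm U')\<^sup>2 - (norm U)\<^sup>2) / 2
    \<le> (\<Sum>i\<in>I. c i * ((norm (W i))\<^sup>2 - (norm U)\<^sup>2)) / 2 - (M / e) * (G \<bullet> U)
      + M * \<tau> / (e\<^sup>2 * r) * (norm G)\<^sup>2"
proof -
  define a where "a = M * r / \<tau>"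
  define Q where "Q = (\<Sum>i\<in>I. c i *\<^sub>R (W i - U))"
  define S where "S = (\<Sum>i\<in>I. c i)"
  define R where "R = (\<Sum>i\<in>I. c i * (norm (W i - U))\<^sup>2)"
  have a: "0 < a" using pos by (simp add: a_def)
  have R: "0 \<le> R" unfolding R_def by (intro sum_nonneg mult_nonneg_nonneg c) auto
  have S: "0 \<le> S" unfolding S_def by (intro sum_nonneg c)
  have "2 * S \<le> a"
  proof (cases "S = 0")
    case False
    then have "\<tau> \<le> M * r / (2 * S)" using cfl by (simp add: S_def)
    then show ?thesis using False S pos by (simp add: a_def field_simps)
  qed (use a in simp)
  have step': "a *\<^sub>R (U' - U) = Q - (M / e) *\<^sub>R G"
    using step by (simp add: a_def Q_def)
  \<comment> \<open>The factor 2 in the time-step restriction compensates the 2 from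
    \<open>norm_diff_squared_le\<close>, so that the transport part of the jump is bounded by
    exactly \<open>R\<close>.\<close>
  have "a * (a * (norm (U' - U))\<^sup>2) = (norm (a *\<^sub>R (U' - U)))\<^sup>2"
    by (simp add: power_mult_distrib power2_eq_square)
  also have "\<dots> \<le> 2 * (norm Q)\<^sup>2 + 2 * (norm ((M / e) *\<^sub>R G))\<^sup>2"
    unfolding step' by (rule norm_diff_squared_le)
  also have "(norm ((M / e) *\<^sub>R G))\<^sup>2 = (M / e)\<^sup>2 * (norm G)\<^sup>2"
    by (simp only: norm_scaleR power_mult_distrib power2_abs)
  also have "(norm Q)\<^sup>2 \<le> S * R"
    unfolding Q_def S_def R_def by (rule norm_weighted_sum_le) (rule c)
  also have "S * R \<le> (a / 2) * R"
    using \<open>2 * S \<le> a\<close> R by (intro mult_right_mono) auto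
  finally have "a * (a * (norm (U' - U))\<^sup>2) \<le> a * (R + 2 * ((M / e)\<^sup>2 / a) * (norm G)\<^sup>2)"
    using a by (simp add: power_mult_distrib algebra_simps)
  then have "a * (norm (U' - U))\<^sup>2 \<le> R + 2 * ((M / e)\<^sup>2 / a) * (norm G)\<^sup>2"
    using a by simp
  also have "(M / e)\<^sup>2 / a = M * \<tau> / (e\<^sup>2 * r)"
    using pos by (simp add: a_def power2_eq_square field_simps)
  finally have jump: "a * (norm (U' - U))\<^sup>2 \<le> R + 2 * (M * \<tau> / (e\<^sup>2 * r)) * (norm G)\<^sup>2" .
  have "a * ((norm U')\<^sup>2 - (norm U)\<^sup>2) = 2 * ((a *\<^sub>R (U' - U)) \<bullet> U) + a * (norm (U' - U))\<^sup>2"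
    by (simp add: power2_norm_eq_inner algebra_simps inner_commute)
  moreover have "(a *\<^sub>R (U' - U)) \<bullet> U = Q \<bullet> U - (M / e) * (G \<bullet> U)"
    unfolding step' by (simp add: inner_diff_left)
  \<comment> \<open>Polarization of each summand produces the upwind dissipation \<open>- R\<close>,
    which cancels the \<open>R\<close> in \<open>jump\<close>.\<close>
  moreover have "2 * (Q \<bullet> U) = (\<Sum>i\<in>I. c i * ((norm (W i))\<^sup>2 - (norm U)\<^sup>2)) - R"
    unfolding Q_def R_def inner_sum_left sum_distrib_left sum_subtractf[symmetric]
    by (intro sum.cong refl) (simp add: power2_norm_eq_inner algebra_simps inner_commute)
  ultimately show ?thesis using jump unfolding a_def[symmetric] by linarith
qed

section \<open>Convexity of the internal energy\<close>

definition psi_deriv :: "real \<Rightarrow> real \<Rightarrow> real" where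
  "psi_deriv \<gamma> r = \<gamma> * r powr (\<gamma> - 1) / (\<gamma> - 1)"

lemma psi_above_tangent:
  assumes "\<gamma> > 1" "0 < x" "0 < y"
  shows "psi_deriv \<gamma> x * (y - x) \<le> psi \<gamma> y - psi \<gamma> x"
proof -
  have der: "(psi \<gamma> has_real_derivative psi_deriv \<gamma> t) (at t)" if "t \<in> {0<..}" for t
  proof -
    have "((\<lambda>t. t powr \<gamma> / (\<gamma> - 1)) has_real_derivative psi_deriv \<gamma> t) (at t)"
      unfolding psi_deriv_def
      by (rule DERIV_cdivide) (use that in \<open>auto intro!: has_real_derivative_powr\<close>)
    then show ?thesis by (simp add: psi_def[abs_def])
  qed
  have "convex_on {0<..} (psi \<gamma>)"
    by (rule convex_on_realI[where f' = "psi_deriv \<gamma>"])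
      (use der assms in \<open>auto simp: psi_deriv_def intro!: divide_right_mono mult_left_mono powr_mono2\<close>)
  then have "psi \<gamma> y - psi \<gamma> x \<ge> psi_deriv \<gamma> x * (y - x)"
    by (rule convex_on_imp_above_tangent)
      (use assms der in \<open>auto intro: has_field_derivative_at_within simp: interior_open\<close>)
  then show ?thesis .
qed

text \<open>This identity turns tangent inequalities for \<open>psi\<close> into inequalities for
  \<open>pressure\<close>.\<close>

lemma psi_deriv_mult:
  assumes "\<gamma> > 1" "0 < x"
  shows "psi_deriv \<gamma> x * x = psi \<gamma> x + pressure \<gamma> x"
proof -
  have "x powr (\<gamma> - 1) * x = x powr \<gamma>" using assms powr_mult_base[of x "\<gamma> - 1"] by (simp add: mult.commute)
  then show ?thesis using assms by (simp add: psi_deriv_def psi_def pressure_def field_simps)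
qed

text \<open>The tangents at \<open>y\<close> and at \<open>x\<close> bound the pressure difference
  from above with the weight \<open>x\<close> and from below with the weight \<open>y\<close>. The
  signs of \<open>a\<close> and \<open>b\<close> match these two bounds, which is why the upwind
  value is the right one.\<close>

lemma upwind_pressure_work:
  assumes "\<gamma> > 1" "0 < x" "0 < y" "0 \<le> a" "b \<le> 0"
  shows "(pressure \<gamma> x - pressure \<gamma> y) * (a + b)
    \<le> (psi_deriv \<gamma> x - psi_deriv \<gamma> y) * (a * x + b * y)"
proof -
  let ?d = "psi_deriv \<gamma>" and ?p = "pressure \<gamma>"
  have x: "?d x * x = psi \<gamma> x + ?p x" and y: "?d y * y = psi \<gamma> y + ?p y"
    using assms by (auto intro: psi_deriv_mult)
  have "?p x - ?p y \<le> (?d x - ?d y) * x"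
    using psi_above_tangent[of \<gamma> y x] x y assms by (simp add: algebra_simps)
  then have "a * (?p x - ?p y) \<le> a * ((?d x - ?d y) * x)"
    using assms by (simp add: mult_left_mono)
  moreover have "(?d x - ?d y) * y \<le> ?p x - ?p y"
    using psi_above_tangent[of \<gamma> x y] x y assms by (simp add: algebra_simps)
  then have "b * (?p x - ?p y) \<le> b * ((?d x - ?d y) * y)"
    using assms by (simp add: mult_left_mono_neg)
  ultimately show ?thesis by (simp add: algebra_simps)
qed

section \<open>Discrete integration by parts and the estimate of one time step\<close>

context periodic_mesh
begin

text \<open>Adding the sum to its reindexing by \<open>sum_nb\<close> moves an antisymmetric flux
  onto the jump of \<open>h\<close>. The factor 2 arises because each edge is visited from both of
  its cells.\<close>

lemma sum_antisym:
  fixes F :: "'a set \<Rightarrow> 'a \<Rightarrow> real"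
  assumes anti: "\<And>K v. K \<in> \<T> \<Longrightarrow> v \<in> axis_normals \<Longrightarrow> F (nb K v) (- v) = - F K v"
  shows "2 * (\<Sum>K\<in>\<T>. \<Sum>v\<in>axis_normals. h K * F K v)
    = (\<Sum>K\<in>\<T>. \<Sum>v\<in>axis_normals. (h K - h (nb K v)) * F K v)"
proof -
  have "(\<Sum>K\<in>\<T>. \<Sum>v\<in>axis_normals. h K * F K v)
      = (\<Sum>K\<in>\<T>. \<Sum>v\<in>axis_normals. h (nb K v) * F (nb K v) (- v))"
    by (rule sum_nb)
  also have "\<dots> = (\<Sum>K\<in>\<T>. \<Sum>v\<in>axis_normals. - (h (nb K v) * F K v))"
    by (intro sum.cong refl) (simp add: anti)
  finally show ?thesis by (simp add: left_diff_distrib sum_subtractf sum_negf)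
qed

lemma edge_vel_face:
  assumes "K \<in> \<T>" "v \<in> axis_normals"
  shows "edge_vel per \<T> w (face K v) K = (w K \<bullet> v + w (nb K v) \<bullet> v) / 2"
  using assms
  by (simp add: edge_vel_def int_edges_eq outer_normal_face inner_add_left flip: nb_def)

lemma edge_vel_nb:
  assumes "K \<in> \<T>" "v \<in> axis_normals"
  shows "edge_vel per \<T> w (face (nb K v) (- v)) (nb K v) = - edge_vel per \<T> w (face K v) K"
  using assms by (simp add: edge_vel_face nb_in uminus_axis_normals nb_nb field_simps)

text \<open>Reversing the normal exchanges positive and negative parts up to sign: outflow from one
  cell is inflow into the other.\<close>

lemma w_plus_minus_nb:
  assumes "K \<in> \<T>" "v \<in> axis_normals"
  shows "w_plus per \<T> u \<delta>u (face (nb K v) (- v)) (nb K v) = - w_minus per \<T> u \<delta>u (face K v) K"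
    and "w_minus per \<T> u \<delta>u (face (nb K v) (- v)) (nb K v) = - w_plus per \<T> u \<delta>u (face K v) K"
  using assms
  by (simp_all add: w_plus_def w_minus_def edge_vel_nb pos_part_def neg_part_def field_simps)

lemma div_up_face:
  assumes "K \<in> \<T>"
  shows "cell_measure K *\<^sub>R div_up per \<T> q wp wm K = (\<Sum>v\<in>axis_normals. edge_measure (face K v) *\<^sub>R
    (wp (face K v) K *\<^sub>R q K + wm (face K v) K *\<^sub>R q (nb K v)))"
  using cell_measure_pos[OF assms] by (simp add: div_up_def sum_int_edges[OF assms] flip: nb_def)

lemma grad_mesh_face:
  assumes "K \<in> \<T>"
  shows "cell_measure K *\<^sub>R grad_mesh per \<T> q K
    = (\<Sum>v\<in>axis_normals. (edge_measure (face K v) * ((q (nb K v) - q K) / 2)) *\<^sub>R v)"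
  using cell_measure_pos[OF assms]
  by (simp add: grad_mesh_def sum_int_edges[OF assms] outer_normal_face[OF assms] flip: nb_def)

text \<open>The upwind flux is antisymmetric by \<open>w_plus_minus_nb\<close>, so
  \<open>sum_antisym\<close> applies.\<close>

lemma sum_div_up:
  fixes q h :: "'a set \<Rightarrow> real" and u \<delta>u
  defines "wp \<equiv> w_plus per \<T> u \<delta>u" and "wm \<equiv> w_minus per \<T> u \<delta>u"
  shows "2 * (\<Sum>K\<in>\<T>. cell_measure K * (h K * div_up per \<T> q wp wm K))
    = (\<Sum>K\<in>\<T>. \<Sum>v\<in>axis_normals. (h K - h (nb K v)) * (edge_measure (face K v) *
        (wp (face K v) K * q K + wm (face K v) K * q (nb K v))))"
proof -
  let ?F = "\<lambda>K v. edge_measure (face K v) * (wp (face K v) K * q K + wm (face K v) K * q (nb K v))"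
  have "(\<Sum>K\<in>\<T>. cell_measure K * (h K * div_up per \<T> q wp wm K))
      = (\<Sum>K\<in>\<T>. h K * (cell_measure K *\<^sub>R div_up per \<T> q wp wm K))"
    by (simp add: mult_ac)
  also have "\<dots> = (\<Sum>K\<in>\<T>. \<Sum>v\<in>axis_normals. h K * ?F K v)"
    by (intro sum.cong refl) (simp only: div_up_face, simp add: sum_distrib_left)
  finally show ?thesis
    by (simp only:, intro sum_antisym)
      (simp add: wp_def wm_def w_plus_minus_nb edge_measure_nb nb_nb algebra_simps)
qed

lemma sum_div_up_eq_0:
  fixes q :: "'a set \<Rightarrow> real"
  shows "(\<Sum>K\<in>\<T>. cell_measure K * div_up per \<T> q (w_plus per \<T> u \<delta>u) (w_minus per \<T> u \<delta>u) K) = 0"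
  using sum_div_up[of "\<lambda>_. 1" q u \<delta>u] by simp

text \<open>Across an edge both the jump of \<open>q\<close> and the normal change sign, so
  reindexing only replaces \<open>w K\<close> by the neighbouring value. Adding both forms yields
  the average in \<open>edge_vel\<close>.\<close>

lemma sum_grad_mesh_inner:
  "2 * (\<Sum>K\<in>\<T>. cell_measure K * (grad_mesh per \<T> q K \<bullet> w K))
    = (\<Sum>K\<in>\<T>. \<Sum>v\<in>axis_normals. edge_measure (face K v) * ((q (nb K v) - q K) *
        edge_vel per \<T> w (face K v) K))"
proof -
  let ?s = "\<lambda>K v. edge_measure (face K v)"
  have A: "(\<Sum>K\<in>\<T>. cell_measure K * (grad_mesh per \<T> q K \<bullet> w K))
      = (\<Sum>K\<in>\<T>. \<Sum>v\<in>axis_normals. ?s K v * ((q (nb K v) - q K) / 2) * (w K \<bullet> v))"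
    (is "_ = ?A")
    by (intro sum.cong refl)
      (simp only: inner_scaleR_left[symmetric] grad_mesh_face,
        simp add: inner_sum_left, simp add: inner_commute)
  also have "\<dots> = (\<Sum>K\<in>\<T>. \<Sum>v\<in>axis_normals. ?s (nb K v) (- v) * ((q (nb (nb K v) (- v)) - q (nb K v)) / 2)
      * (w (nb K v) \<bullet> (- v)))"
    by (rule sum_nb)
  also have "\<dots> = (\<Sum>K\<in>\<T>. \<Sum>v\<in>axis_normals. ?s K v * ((q (nb K v) - q K) / 2) * (w (nb K v) \<bullet> v))"
    by (intro sum.cong refl) (simp add: edge_measure_nb nb_nb field_simps)
  finally have "2 * (\<Sum>K\<in>\<T>. cell_measure K * (grad_mesh per \<T> q K \<bullet> w K))
      = ?A + (\<Sum>K\<in>\<T>. \<Sum>v\<in>axis_normals. ?s K v * ((q (nb K v) - q K) / 2) * (w (nb K v) \<bullet> v))"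
    using A by simp
  also have "\<dots> = (\<Sum>K\<in>\<T>. \<Sum>v\<in>axis_normals. ?s K v * ((q (nb K v) - q K) * edge_vel per \<T> w (face K v) K))"
    unfolding sum.distrib[symmetric]
    by (intro sum.cong refl) (simp add: edge_vel_face field_simps)
  finally show ?thesis .
qed

text \<open>Keeping the dissipation on the left makes the inequality summable in time; decay in a
  single step follows by dropping it.\<close>

lemma energy_step:
  fixes \<gamma> \<epsilon> \<eta> \<delta>t :: real and r r' :: "'a set \<Rightarrow> real" and u u' :: "'a set \<Rightarrow> 'a"
  defines "\<delta>u \<equiv> vel_shift per \<T> \<gamma> \<epsilon> \<eta> \<delta>t r'"
  defines "wp \<equiv> w_plus per \<T> u \<delta>u" and "wm \<equiv> w_minus per \<T> u \<delta>u"
  assumes gamma: "\<gamma> > 1" and eps: "\<epsilon> > 0" and dt: "\<delta>t > 0"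
    and r: "\<And>K. K \<in> \<T> \<Longrightarrow> 0 < r K" and r': "\<And>K. K \<in> \<T> \<Longrightarrow> 0 < r' K"
    and mass: "\<And>K. K \<in> \<T> \<Longrightarrow> (r' K - r K) / \<delta>t + div_up per \<T> r' wp wm K = 0"
    and momentum: "\<And>K. K \<in> \<T> \<Longrightarrow> (1 / \<delta>t) *\<^sub>R (r' K *\<^sub>R u' K - r K *\<^sub>R u K)
      + div_up per \<T> (\<lambda>L. r' L *\<^sub>R u L) wp wm K + (1 / \<epsilon>\<^sup>2) *\<^sub>R grad_p per \<T> \<gamma> r' K = 0"
    and cfl: "\<And>K. K \<in> \<T> \<Longrightarrow> inflow per \<T> \<gamma> \<epsilon> \<eta> \<delta>t r' u K \<noteq> 0 \<Longrightarrow>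
      \<delta>t \<le> cell_measure K * r' K / (2 * inflow per \<T> \<gamma> \<epsilon> \<eta> \<delta>t r' u K)"
  shows "energy \<T> \<gamma> \<epsilon> r' u' + 1 / \<epsilon>^4 * (\<delta>t\<^sup>2 * (\<Sum>K\<in>\<T>. cell_measure K * (\<eta> - 1 / r' K)
      * (norm (grad_p per \<T> \<gamma> r' K))\<^sup>2)) \<le> energy \<T> \<gamma> \<epsilon> r u"
proof -
  define G where "G = grad_p per \<T> \<gamma> r'"
  define m where "m = (\<lambda>K::'a set. cell_measure K)"
  define s where "s = (\<lambda>(K::'a set) v. edge_measure (face K v))"
  \<comment> \<open>The transported kinetic energy combines the new density with the old velocity,
    as the momentum flux does.\<close>
  define q where "q = (\<lambda>L. r' L * (norm (u L))\<^sup>2 / 2)"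
  have m: "0 < m K" if "K \<in> \<T>" for K using cell_measure_pos[OF that] by (simp add: m_def)
  have wm_le: "wm \<sigma> K \<le> 0" and wp_ge: "0 \<le> wp \<sigma> K" for \<sigma> K
    by (simp_all add: wm_def wp_def w_splitting)

  have kinetic: "m K * (r' K * (norm (u' K))\<^sup>2 / 2 - r K * (norm (u K))\<^sup>2 / 2) / \<delta>t
      \<le> - (m K * div_up per \<T> q wp wm K) - m K / \<epsilon>\<^sup>2 * (G K \<bullet> u K)
        + m K * \<delta>t / (\<epsilon>^4 * r' K) * (norm (G K))\<^sup>2" if K: "K \<in> \<T>" for K
  proof -
    \<comment> \<open>The mass flux into \<open>K\<close> through each edge; its sum is the
      denominator of the time-step restriction up to the factor 2.\<close>
    define c where "c = (\<lambda>v. s K v * (- wm (face K v) K) * r' (nb K v))"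
    have c: "0 \<le> c v" if "v \<in> axis_normals" for v
      unfolding c_def s_def edge_measure_def using r'[OF nb_in[OF K that]] wm_le
      by (intro mult_nonneg_nonneg) auto
    have inflow: "inflow per \<T> \<gamma> \<epsilon> \<eta> \<delta>t r' u K = (\<Sum>v\<in>axis_normals. c v)"
      by (simp add: inflow_def sum_int_edges[OF K] c_def s_def wm_def \<delta>u_def mult_ac flip: nb_def)
    have mass_K: "m K * (r' K - r K) / \<delta>t
        = - (\<Sum>v\<in>axis_normals. s K v * (wp (face K v) K * r' K + wm (face K v) K * r' (nb K v)))"
    proof -
      have "m K * (r' K - r K) / \<delta>t = - (m K *\<^sub>R div_up per \<T> r' wp wm K)"
        using arg_cong[OF mass[OF K], of "\<lambda>x. m K * x"] by (simp add: distrib_left)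
      then show ?thesis unfolding m_def div_up_face[OF K] by (simp add: s_def)
    qed
    have cancel: "A = P - E" if "X + D + E = 0" "X = A + B" "D + B = - P" for A B D E P X :: 'a
    proof -
      have "A + (D + B) + E = 0" using that(1,2) by (simp add: algebra_simps)
      then show ?thesis unfolding that(3) by (simp add: algebra_simps)
    qed
    have "(m K / \<delta>t) *\<^sub>R (r' K *\<^sub>R u' K - r K *\<^sub>R u K) + m K *\<^sub>R div_up per \<T> (\<lambda>L. r' L *\<^sub>R u L) wp wm K
        + (m K / \<epsilon>\<^sup>2) *\<^sub>R G K = 0"
      using arg_cong[OF momentum[OF K], of "\<lambda>x. m K *\<^sub>R x"] by (simp add: scaleR_add_right G_def)
    moreover have "(m K / \<delta>t) *\<^sub>R (r' K *\<^sub>R u' K - r K *\<^sub>R u K)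
        = (m K * r' K / \<delta>t) *\<^sub>R (u' K - u K) + (m K * (r' K - r K) / \<delta>t) *\<^sub>R u K"
      by (simp add: algebra_simps diff_divide_distrib)
    \<comment> \<open>Subtracting \<open>u K\<close> times the mass balance removes the outflow
      terms; only differences to neighbours, weighted by inflow, survive.\<close>
    moreover have "m K *\<^sub>R div_up per \<T> (\<lambda>L. r' L *\<^sub>R u L) wp wm K + (m K * (r' K - r K) / \<delta>t) *\<^sub>R u K
        = - (\<Sum>v\<in>axis_normals. c v *\<^sub>R (u (nb K v) - u K))"
      unfolding mass_K
      unfolding m_def div_up_face[OF K] scaleR_minus_left scaleR_sum_left sum_negf[symmetric]
        sum.distrib[symmetric]
      by (intro sum.cong refl) (simp add: c_def s_def algebra_simps)
    ultimately have step: "(m K * r' K / \<delta>t) *\<^sub>R (u' K - u K)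
        = (\<Sum>v\<in>axis_normals. c v *\<^sub>R (u (nb K v) - u K)) - (m K / \<epsilon>\<^sup>2) *\<^sub>R G K"
      by (rule cancel)
    have "(m K * r' K / \<delta>t) * ((norm (u' K))\<^sup>2 - (norm (u K))\<^sup>2) / 2
        \<le> (\<Sum>v\<in>axis_normals. c v * ((norm (u (nb K v)))\<^sup>2 - (norm (u K))\<^sup>2)) / 2
          - (m K / \<epsilon>\<^sup>2) * (G K \<bullet> u K) + m K * \<delta>t / ((\<epsilon>\<^sup>2)\<^sup>2 * r' K) * (norm (G K))\<^sup>2"
    proof (rule explicit_step_kinetic_energy[OF m[OF K] dt r'[OF K] _ c step])
      show "0 < \<epsilon>\<^sup>2" using eps by simp
      show "\<delta>t \<le> m K * r' K / (2 * sum c axis_normals)" if "sum c axis_normals \<noteq> 0"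
        using cfl[OF K] that unfolding inflow m_def by blast
    qed
    \<comment> \<open>Conversely, adding half of the squared norm of \<open>u K\<close> times the
      mass balance restores the conservative flux of \<open>q\<close>, which sums to zero over the
      mesh.\<close>
    moreover have "(\<Sum>v\<in>axis_normals. c v * ((norm (u (nb K v)))\<^sup>2 - (norm (u K))\<^sup>2)) / 2
        + m K * (r' K - r K) / \<delta>t * (norm (u K))\<^sup>2 / 2 = - (m K *\<^sub>R div_up per \<T> q wp wm K)"
      unfolding mass_K
      unfolding m_def div_up_face[OF K] mult_minus_left minus_divide_left[symmetric] sum_distrib_right
        sum_divide_distrib sum_negf[symmetric] sum.distrib[symmetric]
      by (intro sum.cong refl) (simp add: c_def s_def q_def field_simps)
    moreover have "m K * (r' K * (norm (u' K))\<^sup>2 / 2 - r K * (norm (u K))\<^sup>2 / 2) / \<delta>t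
        = (m K * r' K / \<delta>t) * ((norm (u' K))\<^sup>2 - (norm (u K))\<^sup>2) / 2
          + m K * (r' K - r K) / \<delta>t * (norm (u K))\<^sup>2 / 2"
      using dt by (simp add: field_simps)
    ultimately show ?thesis by (simp flip: power_mult)
  qed

  \<comment> \<open>The tangent is taken at the new density, the one at which the mass flux is
    evaluated.\<close>
  have potential: "m K * (psi \<gamma> (r' K) - psi \<gamma> (r K)) / \<delta>t
      \<le> - (m K * (psi_deriv \<gamma> (r' K) * div_up per \<T> r' wp wm K))" if K: "K \<in> \<T>" for K
  proof -
    have "psi \<gamma> (r' K) - psi \<gamma> (r K) \<le> psi_deriv \<gamma> (r' K) * (r' K - r K)"
      using psi_above_tangent[OF gamma r'[OF K] r[OF K]] by (simp add: algebra_simps)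
    then have "m K / \<delta>t * (psi \<gamma> (r' K) - psi \<gamma> (r K)) \<le> m K / \<delta>t * (psi_deriv \<gamma> (r' K) * (r' K - r K))"
      using m[OF K] dt by (intro mult_left_mono) auto
    moreover have "(r' K - r K) / \<delta>t = - div_up per \<T> r' wp wm K"
      using mass[OF K] by linarith
    then have "m K * (psi_deriv \<gamma> (r' K) * ((r' K - r K) / \<delta>t))
        = - (m K * (psi_deriv \<gamma> (r' K) * div_up per \<T> r' wp wm K))"
      by simp
    ultimately show ?thesis by (simp add: mult_ac)
  qed

  \<comment> \<open>The edge velocity of \<open>u - \<delta>u\<close> is the sum of
    \<open>wp\<close> and \<open>wm\<close>, so the upwind inequality applies edge by edge.\<close>
  have pressure_work: "- (\<Sum>K\<in>\<T>. m K * (G K \<bullet> (u K - \<delta>u K)))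
      \<le> (\<Sum>K\<in>\<T>. m K * (psi_deriv \<gamma> (r' K) * div_up per \<T> r' wp wm K))"
  proof -
    have "- (2 * (\<Sum>K\<in>\<T>. m K * (G K \<bullet> (u K - \<delta>u K))))
        = (\<Sum>K\<in>\<T>. \<Sum>v\<in>axis_normals. s K v * ((pressure \<gamma> (r' K) - pressure \<gamma> (r' (nb K v)))
            * (wp (face K v) K + wm (face K v) K)))"
      unfolding m_def G_def grad_p_def sum_grad_mesh_inner sum_negf[symmetric] wp_def wm_def
        w_splitting(1)
      by (intro sum.cong refl) (simp add: s_def algebra_simps)
    also have "\<dots> \<le> (\<Sum>K\<in>\<T>. \<Sum>v\<in>axis_normals. s K v * ((psi_deriv \<gamma> (r' K) - psi_deriv \<gamma> (r' (nb K v)))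
            * (wp (face K v) K * r' K + wm (face K v) K * r' (nb K v))))"
      by (intro sum_mono mult_left_mono upwind_pressure_work gamma r' nb_in wp_ge wm_le)
        (auto simp: s_def edge_measure_def)
    also have "\<dots> = 2 * (\<Sum>K\<in>\<T>. m K * (psi_deriv \<gamma> (r' K) * div_up per \<T> r' wp wm K))"
      unfolding m_def wp_def wm_def sum_div_up by (simp add: s_def mult_ac)
    finally show ?thesis by simp
  qed

  \<comment> \<open>Conservation of total mass disposes of the linear term by which
    \<open>rel_psi\<close> differs from \<open>psi\<close>.\<close>
  have conserved: "(\<Sum>K\<in>\<T>. m K * (r' K - r K)) = 0"
  proof -
    have "(\<Sum>K\<in>\<T>. m K * (r' K - r K)) = (\<Sum>K\<in>\<T>. - \<delta>t * (m K * div_up per \<T> r' wp wm K))"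
    proof (intro sum.cong refl)
      fix K assume "K \<in> \<T>"
      then have "r' K - r K = - \<delta>t * div_up per \<T> r' wp wm K"
        using mass[of K] dt by (simp add: field_simps)
      then show "m K * (r' K - r K) = - \<delta>t * (m K * div_up per \<T> r' wp wm K)" by simp
    qed
    also have "\<dots> = 0"
      unfolding sum_distrib_left[symmetric] m_def wp_def wm_def sum_div_up_eq_0 by simp
    finally show ?thesis .
  qed

  have "energy \<T> \<gamma> \<epsilon> r' u' - energy \<T> \<gamma> \<epsilon> r u
      = (\<Sum>K\<in>\<T>. m K * (r' K * (norm (u' K))\<^sup>2 / 2 - r K * (norm (u K))\<^sup>2 / 2))
        + (\<Sum>K\<in>\<T>. m K * (psi \<gamma> (r' K) - psi \<gamma> (r K))) / \<epsilon>\<^sup>2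
        - deriv (psi \<gamma>) 1 / \<epsilon>\<^sup>2 * (\<Sum>K\<in>\<T>. m K * (r' K - r K))"
    unfolding energy_def sum_subtractf[symmetric] sum_distrib_left sum_divide_distrib sum.distrib[symmetric]
    using eps by (intro sum.cong refl) (simp add: m_def rel_psi_def field_simps)
  also have "\<dots> = \<delta>t * ((\<Sum>K\<in>\<T>. m K * (r' K * (norm (u' K))\<^sup>2 / 2 - r K * (norm (u K))\<^sup>2 / 2) / \<delta>t)
        + (\<Sum>K\<in>\<T>. m K * (psi \<gamma> (r' K) - psi \<gamma> (r K)) / \<delta>t) / \<epsilon>\<^sup>2)"
    unfolding conserved sum_divide_distrib[symmetric] using dt eps by (simp add: field_simps)
  also have "\<dots> \<le> \<delta>t * ((\<Sum>K\<in>\<T>. - (m K * div_up per \<T> q wp wm K) - m K / \<epsilon>\<^sup>2 * (G K \<bullet> u K)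
        + m K * \<delta>t / (\<epsilon>^4 * r' K) * (norm (G K))\<^sup>2)
      + (\<Sum>K\<in>\<T>. - (m K * (psi_deriv \<gamma> (r' K) * div_up per \<T> r' wp wm K))) / \<epsilon>\<^sup>2)"
    using dt eps kinetic potential
    by (intro mult_left_mono add_mono divide_right_mono sum_mono) auto
  also have "(\<Sum>K\<in>\<T>. - (m K * (psi_deriv \<gamma> (r' K) * div_up per \<T> r' wp wm K))) / \<epsilon>\<^sup>2
      \<le> (\<Sum>K\<in>\<T>. m K * (G K \<bullet> (u K - \<delta>u K))) / \<epsilon>\<^sup>2"
    using pressure_work by (intro divide_right_mono) (auto simp: sum_negf)
  also have "(\<Sum>K\<in>\<T>. - (m K * div_up per \<T> q wp wm K) - m K / \<epsilon>\<^sup>2 * (G K \<bullet> u K)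
        + m K * \<delta>t / (\<epsilon>^4 * r' K) * (norm (G K))\<^sup>2) + (\<Sum>K\<in>\<T>. m K * (G K \<bullet> (u K - \<delta>u K))) / \<epsilon>\<^sup>2
      = (\<Sum>K\<in>\<T>. - (\<delta>t / \<epsilon>^4 * (m K * (\<eta> - 1 / r' K) * (norm (G K))\<^sup>2)))
        - (\<Sum>K\<in>\<T>. m K * div_up per \<T> q wp wm K)"
    unfolding sum_divide_distrib sum.distrib[symmetric] sum_subtractf[symmetric]
  proof (intro sum.cong refl)
    fix K assume K: "K \<in> \<T>"
    \<comment> \<open>The shift is a multiple of \<open>G K\<close>, so the work against it is a
      square, of the same form as the explicit pressure error.\<close>
    have work: "G K \<bullet> (u K - \<delta>u K) = G K \<bullet> u K - \<eta> * \<delta>t / \<epsilon>\<^sup>2 * (norm (G K))\<^sup>2"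
      by (simp add: \<delta>u_def vel_shift_def G_def inner_diff_right power2_norm_eq_inner)
    show "- (m K * div_up per \<T> q wp wm K) - m K / \<epsilon>\<^sup>2 * (G K \<bullet> u K)
        + m K * \<delta>t / (\<epsilon>^4 * r' K) * (norm (G K))\<^sup>2 + m K * (G K \<bullet> (u K - \<delta>u K)) / \<epsilon>\<^sup>2
      = - (\<delta>t / \<epsilon>^4 * (m K * (\<eta> - 1 / r' K) * (norm (G K))\<^sup>2)) - m K * div_up per \<T> q wp wm K"
      unfolding work using eps r'[OF K] by (simp add: field_simps)
  qed
  also have "(\<Sum>K\<in>\<T>. m K * div_up per \<T> q wp wm K) = 0"
    unfolding m_def wp_def wm_def by (rule sum_div_up_eq_0)
  finally have "energy \<T> \<gamma> \<epsilon> r' u' - energy \<T> \<gamma> \<epsilon> r u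
      \<le> \<delta>t * (\<Sum>K\<in>\<T>. - (\<delta>t / \<epsilon>^4 * (m K * (\<eta> - 1 / r' K) * (norm (G K))\<^sup>2)))"
    using dt by (simp add: mult_left_mono)
  then show ?thesis
    unfolding sum_negf sum_distrib_left[symmetric] m_def G_def
    by (simp add: power2_eq_square mult_ac)
qed

end

section \<open>Summation over the time steps\<close>

theorem corollary5p15:
  fixes per :: "'a::euclidean_space"
    and \<T> :: "'a set set"
    and \<gamma> T C0 :: real
    and \<rho>0 :: "real \<Rightarrow> 'a \<Rightarrow> real"
    and u0 :: "real \<Rightarrow> 'a \<Rightarrow> 'a"
  assumes dim: "DIM('a) = 2 \<or> DIM('a) = 3"
    and mesh: "torus_mesh per \<T>"
    and gamma: "\<gamma> > 1"
    and final_time: "T > 0"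
    and data: "\<And>\<epsilon>. \<epsilon> > 0 \<Longrightarrow> initial_data per (\<rho>0 \<epsilon>) (u0 \<epsilon>)"
    and energy0: "\<And>\<epsilon>. \<epsilon> > 0 \<Longrightarrow> energy \<T> \<gamma> \<epsilon> (cell_mean (\<rho>0 \<epsilon>)) (cell_mean (u0 \<epsilon>)) \<le> C0"
  shows "\<exists>C>0. \<forall>\<epsilon>>0. \<forall>\<eta>>0. \<forall>\<delta>t>0. \<forall>N \<rho> u.
      real N * \<delta>t = T \<longrightarrow>
      discrete_solution per \<T> \<gamma> \<epsilon> \<eta> \<delta>t N (\<rho>0 \<epsilon>) (u0 \<epsilon>) \<rho> u \<longrightarrow>
      (\<forall>n<N. \<forall>K\<in>\<T>. \<eta> > 1 / \<rho> (Suc n) K) \<longrightarrow>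
      time_step_condition per \<T> \<gamma> \<epsilon> \<eta> \<delta>t N \<rho> u \<longrightarrow>
      (\<forall>n<N. energy \<T> \<gamma> \<epsilon> (\<rho> (Suc n)) (u (Suc n)) \<le> energy \<T> \<gamma> \<epsilon> (\<rho> n) (u n)) \<and>
      (\<forall>n\<le>N. energy \<T> \<gamma> \<epsilon> (\<rho> n) (u n)
          + 1 / \<epsilon>^4 * (\<Sum>r<n. \<delta>t\<^sup>2 * (\<Sum>K\<in>\<T>. cell_measure K
                * (\<eta> - 1 / \<rho> (Suc r) K) * (norm (grad_p per \<T> \<gamma> (\<rho> (Suc r)) K))\<^sup>2))
        \<le> C)"
proof -
  interpret periodic_mesh per \<T> by unfold_locales (rule mesh)
  define dissipation where "dissipation = (\<lambda>\<eta> \<delta>t (r :: 'a set \<Rightarrow> real). \<delta>t\<^sup>2 * (\<Sum>K\<in>\<T>. cell_measure K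
    * (\<eta> - 1 / r K) * (norm (grad_p per \<T> \<gamma> r K))\<^sup>2))"
  \<comment> \<open>The bound is built from \<open>C0\<close> alone, hence is uniform in
    \<open>\<epsilon>\<close> and in the discretization parameters; absolute value and 1 make it
    positive for any sign of \<open>C0\<close>.\<close>
  have "(\<forall>n<N. energy \<T> \<gamma> \<epsilon> (\<rho> (Suc n)) (u (Suc n)) \<le> energy \<T> \<gamma> \<epsilon> (\<rho> n) (u n)) \<and>
      (\<forall>n\<le>N. energy \<T> \<gamma> \<epsilon> (\<rho> n) (u n)
        + 1 / \<epsilon>^4 * (\<Sum>i<n. dissipation \<eta> \<delta>t (\<rho> (Suc i))) \<le> \<bar>C0\<bar> + 1)"
    if eps: "\<epsilon> > 0" and dt: "\<delta>t > 0"
      and sol: "discrete_solution per \<T> \<gamma> \<epsilon> \<eta> \<delta>t N (\<rho>0 \<epsilon>) (u0 \<epsilon>) \<rho> u"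
      and eta: "\<forall>n<N. \<forall>K\<in>\<T>. \<eta> > 1 / \<rho> (Suc n) K"
      and cfl: "time_step_condition per \<T> \<gamma> \<epsilon> \<eta> \<delta>t N \<rho> u"
    for \<epsilon> \<eta> \<delta>t :: real and N \<rho> u
  proof -
    have step: "energy \<T> \<gamma> \<epsilon> (\<rho> (Suc n)) (u (Suc n)) + 1 / \<epsilon>^4 * dissipation \<eta> \<delta>t (\<rho> (Suc n))
        \<le> energy \<T> \<gamma> \<epsilon> (\<rho> n) (u n)" if n: "n < N" for n
      unfolding dissipation_def
      by (rule energy_step[OF gamma eps dt])
        (use sol cfl n in \<open>simp_all add: discrete_solution_def time_step_condition_def Let_def\<close>)
    have nonneg: "0 \<le> 1 / \<epsilon>^4 * dissipation \<eta> \<delta>t (\<rho> (Suc n))" if "n < N" for n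
      unfolding dissipation_def
      using eta that by (intro mult_nonneg_nonneg sum_nonneg) (auto simp: less_imp_le)
    have "energy \<T> \<gamma> \<epsilon> (\<rho> 0) (u 0) = energy \<T> \<gamma> \<epsilon> (cell_mean (\<rho>0 \<epsilon>)) (cell_mean (u0 \<epsilon>))"
      using sol by (simp add: energy_def discrete_solution_def)
    then have start: "energy \<T> \<gamma> \<epsilon> (\<rho> 0) (u 0) \<le> \<bar>C0\<bar> + 1"
      using energy0[OF eps] by linarith
    \<comment> \<open>The sum telescopes: the term added at \<open>Suc n\<close> is the dissipation
      that \<open>step\<close> balances against the loss of energy from \<open>n\<close> to
      \<open>Suc n\<close>.\<close>
    have "energy \<T> \<gamma> \<epsilon> (\<rho> n) (u n) + 1 / \<epsilon>^4 * (\<Sum>i<n. dissipation \<eta> \<delta>t (\<rho> (Suc i)))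
        \<le> \<bar>C0\<bar> + 1" if "n \<le> N" for n
      using that
    proof (induction n)
      case 0
      then show ?case using start by simp
    next
      case (Suc n)
      then show ?case using step[of n] by (simp add: distrib_left)
    qed
    moreover have "energy \<T> \<gamma> \<epsilon> (\<rho> (Suc n)) (u (Suc n)) \<le> energy \<T> \<gamma> \<epsilon> (\<rho> n) (u n)" if "n < N" for n
      using step[OF that] nonneg[OF that] by linarith
    ultimately show ?thesis by blast
  qed
  then show ?thesis
    unfolding dissipation_def by (intro exI[of _ "\<bar>C0\<bar> + 1"]) auto
qed

end
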